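(* Let $n$ and $k$ be positive integers with $n\ge 42.5k+48$. Then every edge-colored graph $G$ of order $n$ with $\delta^c(G)\ge \frac{n+k}{2}$ contains $k$ vertex-disjoint rainbow triangles.
   Context: Graphs are finite and simple. An edge-colored graph is a graph $G$ together with a mapping $E(G)\to\mathbb{N}$ (not necessarily a proper coloring). For a vertex $v$, the color degree $d^c(v)$ is the number of different colors appearing on the edges incident to $v$, and the minimum color degree is $\delta^c(G)=\min\{d^c(v): v\in V(G)\}$. A triangle is rainbow if its three edges have pairwise different colors. "$k$ vertex-disjoint rainbow triangles" means $k$ pairwise vertex-disjoint triangles each of which is rainbow individually; different triangles are allowed to share colors. *)

theory Defs
  imports Complex_Main "HOL-Library.Disjoint_Sets" "HOL-Library.Ramsey"
begin

text \<open>
  A graph is given by its vertex set \<open>V\<close> and its edge set \<open>E\<close>, the edges being two-element subsets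
  of \<open>V\<close> (\<open>[V]\<^bsup>2\<^esup>\<close> is written \<open>nsets V 2\<close>). An edge coloring is a function \<open>c\<close> of which only
  the values on \<open>E\<close> are ever used.
\<close>

definition finite_simple_graph :: "'a set \<Rightarrow> 'a set set \<Rightarrow> bool" where
  "finite_simple_graph V E \<longleftrightarrow> finite V \<and> E \<subseteq> nsets V 2"

definition color_degree :: "'a set set \<Rightarrow> ('a set \<Rightarrow> nat) \<Rightarrow> 'a \<Rightarrow> nat" where
  "color_degree E c v = card (c ` {e \<in> E. v \<in> e})"

text \<open>Meaningful only for finite nonempty \<open>V\<close>.\<close>

definition min_color_degree :: "'a set \<Rightarrow> 'a set set \<Rightarrow> ('a set \<Rightarrow> nat) \<Rightarrow> nat" where
  "min_color_degree V E c = Min (color_degree E c ` V)"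

text \<open>A triangle is identified with its vertex set \<open>T\<close>; its edges are then the elements of \<open>nsets T 2\<close>.\<close>

definition triangle :: "'a set \<Rightarrow> 'a set set \<Rightarrow> 'a set \<Rightarrow> bool" where
  "triangle V E T \<longleftrightarrow> T \<in> nsets V 3 \<and> nsets T 2 \<subseteq> E"

definition rainbow_triangle :: "'a set \<Rightarrow> 'a set set \<Rightarrow> ('a set \<Rightarrow> nat) \<Rightarrow> 'a set \<Rightarrow> bool" where
  "rainbow_triangle V E c T \<longleftrightarrow> triangle V E T \<and> inj_on c (nsets T 2)"

end

theory Submission
  imports Defs
begin

text \<open>
  Induction on \<open>k\<close>: deleting \<open>j\<close> vertices lowers every color degree by at most \<open>j\<close>, so for every nonempty
  set \<open>B\<close> of at most \<open>k\<close> vertices there are \<open>k - |B|\<close> disjoint rainbow triangles avoiding \<open>B\<close>. Suppose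
  that there are no \<open>k\<close> disjoint ones, and call a pair of vertices heavy if it lies in at least
  \<open>3k - 2\<close> rainbow triangles. A greedy extension shows that the heavy pairs contain no matching of
  size \<open>k\<close> and that every set of \<open>j \<le> k\<close> vertices has a member of heavy degree at most \<open>3k - 2 - j\<close>;
  hence there are at most \<open>(k - 1) (3k - 2)\<close> heavy pairs. All triangles and all heavy pairs meet the
  \<open>3 (k - 1)\<close> vertices of a maximal packing, which bounds the number of rainbow triangles by
  \<open>(k - 1) (3k - 2) (n - 3k + 1) + 27 (k - 1)\<^sup>3\<close>. On the other hand, counting triangles by common
  neighbors and discarding those with two edges of equal color leaves at least
  \<open>n k (n + k) / 12\<close>, which is larger.
\<close>

section \<open>Matchings and degrees\<close>

lemma card_Union_nsets:
  assumes "finite F" "F \<subseteq> nsets V r" "disjoint F"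
  shows "card (\<Union>F) = r * card F"
proof -
  have "card (\<Union>F) = sum card F"
    using assms by (intro card_Union_disjoint) (auto simp: disjoint_def pairwise_def disjnt_def nsets_def)
  also have "\<dots> = (\<Sum>e\<in>F. r)"
    using assms(2) by (intro sum.cong) (auto simp: nsets_def)
  finally show ?thesis by simp
qed

lemma disjoint_insertI:
  assumes "disjoint F" "\<Union>F \<inter> e = {}"
  shows "disjoint (insert e F)"
  using assms by (auto simp: disjoint_def pairwise_def disjnt_def)

section \<open>Neighborhoods and edge counts\<close>

definition graph_nbrs :: "'a set set \<Rightarrow> 'a \<Rightarrow> 'a set" where
  "graph_nbrs H v = {u. {v, u} \<in> H}"

lemma graph_nbrs_subset: "H \<subseteq> nsets V 2 \<Longrightarrow> graph_nbrs H v \<subseteq> V - {v}"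
  by (auto simp: graph_nbrs_def nsets_def card_insert_if split: if_splits)

lemma finite_graph_nbrs: "finite V \<Longrightarrow> H \<subseteq> nsets V 2 \<Longrightarrow> finite (graph_nbrs H v)"
  by (meson finite_Diff finite_subset graph_nbrs_subset)

lemma edges_at_eq_image:
  assumes "H \<subseteq> nsets V 2"
  shows "{e \<in> H. v \<in> e} = (\<lambda>u. {v, u}) ` graph_nbrs H v"
proof -
  have "e \<in> (\<lambda>u. {v, u}) ` graph_nbrs H v" if "e \<in> H" "v \<in> e" for e
  proof -
    from that assms have "card e = 2" by (auto simp: nsets_def)
    then obtain x y where "e = {x, y}" "x \<noteq> y" by (auto simp: card_2_iff)
    with that show ?thesis by (auto simp: graph_nbrs_def insert_commute)
  qed
  then show ?thesis by (auto simp: graph_nbrs_def)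
qed

lemma card_edges_at:
  assumes "H \<subseteq> nsets V 2"
  shows "card {e \<in> H. v \<in> e} = card (graph_nbrs H v)"
  unfolding edges_at_eq_image[OF assms]
  by (intro card_image) (auto simp: inj_on_def doubleton_eq_iff)

text \<open>In a maximum matching the two ends of an edge cannot have distinct neighbors outside the
  matching, so one end, called \<open>y\<close>, has at most one such neighbor. With
  \<open>X\<close> the set of the other ends, every edge meets \<open>X\<close>, joins two of the
  ends \<open>y\<close>, or leads from some \<open>y\<close> out of the matching. These three kinds
  give the three summands.\<close>

lemma edge_count_via_maximum_matching:
  fixes H :: "'a set set"
  assumes V: "finite V" and H: "H \<subseteq> nsets V 2"
    and small: "\<And>M. M \<subseteq> H \<Longrightarrow> disjoint M \<Longrightarrow> card M \<le> m"
  obtains X where "X \<subseteq> V" "card X \<le> m"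
    "card H \<le> (\<Sum>x\<in>X. card (graph_nbrs H x)) + (card X choose 2) + card X"
proof -
  have finH: "finite H" using H V by (meson finite_imp_finite_nsets finite_subset)
  have "\<exists>M. M \<subseteq> H \<and> disjoint M \<and> (\<forall>M'. M' \<subseteq> H \<and> disjoint M' \<longrightarrow> card M' \<le> card M)"
    using ex_has_greatest_nat[of "\<lambda>M. M \<subseteq> H \<and> disjoint M" "{}" card "Suc m"] small
    by (auto simp: less_Suc_eq_le)
  then obtain M where M: "M \<subseteq> H" "disjoint M"
    and max: "\<And>M'. M' \<subseteq> H \<Longrightarrow> disjoint M' \<Longrightarrow> card M' \<le> card M"
    by blast
  have finM: "finite M" using M finH finite_subset by blast
  define out where "out = (\<lambda>v. graph_nbrs H v - \<Union>M)"
  \<comment> \<open>Otherwise \<open>{x, u}\<close> and \<open>{y, w}\<close> could replace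
    \<open>{x, y}\<close> and enlarge the matching.\<close>
  have augment: "u = w" if e: "{x, y} \<in> M" "u \<in> out x" "w \<in> out y" for x y u w
  proof (rule ccontr)
    assume "u \<noteq> w"
    have "x \<noteq> y" using e(1) M(1) H by (auto simp: nsets_def)
    let ?M0 = "M - {{x, y}}"
    let ?M' = "insert {x, u} (insert {y, w} ?M0)"
    have d0: "disjoint ?M0" using M(2) by (auto simp: disjoint_def pairwise_def)
    have xy: "x \<notin> \<Union>?M0" "y \<notin> \<Union>?M0"
      using disjointD[OF M(2) _ e(1)] by blast+
    have uw: "u \<notin> \<Union>M" "w \<notin> \<Union>M" using e by (auto simp: out_def)
    moreover have xyM: "x \<in> \<Union>M" "y \<in> \<Union>M" using e(1) by auto
    ultimately have ne: "u \<noteq> x" "u \<noteq> y" "w \<noteq> x" "w \<noteq> y" by auto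
    have d1: "disjoint (insert {y, w} ?M0)"
      by (rule disjoint_insertI[OF d0]) (use xy uw in auto)
    have "disjoint ?M'"
      by (rule disjoint_insertI[OF d1]) (use xy uw ne \<open>u \<noteq> w\<close> \<open>x \<noteq> y\<close> in auto)
    moreover have "?M' \<subseteq> H" using e M(1) by (auto simp: out_def graph_nbrs_def)
    ultimately have le: "card ?M' \<le> card M" by (rule max[rotated])
    have "{y, w} \<notin> ?M0" "{x, u} \<notin> ?M0" using xy by blast+
    moreover have "{x, u} \<noteq> {y, w}" using ne \<open>x \<noteq> y\<close> by (simp add: doubleton_eq_iff)
    ultimately have "card ?M' = Suc (Suc (card ?M0))" using finM by simp
    moreover have "Suc (card ?M0) = card M" by (rule card.remove[OF finM e(1), symmetric])
    ultimately show False using le by simp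
  qed
  \<comment> \<open>If \<open>out x\<close> is empty, the two ends exchange their names. Otherwise
    any element of \<open>out x\<close> is the only possible element of
    \<open>out y\<close>.\<close>
  have "\<exists>x y. e = {x, y} \<and> card (out y) \<le> 1" if "e \<in> M" for e
  proof -
    from that M(1) H have "card e = 2" by (auto simp: nsets_def)
    then obtain x y where xy: "e = {x, y}" "x \<noteq> y" by (auto simp: card_2_iff)
    show ?thesis
    proof (cases "out x = {}")
      case True
      have "e = {y, x}" using xy(1) by blast
      moreover have "card (out x) \<le> 1" using True by simp
      ultimately show ?thesis by blast
    next
      case False
      then obtain u where "u \<in> out x" by auto
      with augment that xy have "out y \<subseteq> {u}" by blast
      then have "card (out y) \<le> 1" using card_mono[of "{u}" "out y"] by simp
      with xy show ?thesis by blast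
    qed
  qed
  then obtain x y where xy: "\<And>e. e \<in> M \<Longrightarrow> e = {x e, y e} \<and> card (out (y e)) \<le> 1"
    by metis
  have MXY: "\<Union>M \<subseteq> x ` M \<union> y ` M" using xy by blast
  have injx: "inj_on x M"
  proof (rule inj_onI)
    fix e f assume "e \<in> M" "f \<in> M" "x e = x f"
    then have "e \<inter> f \<noteq> {}" using xy[of e] xy[of f] by auto
    then show "e = f" using M(2) \<open>e \<in> M\<close> \<open>f \<in> M\<close> by (auto simp: disjoint_def)
  qed
  let ?X = "x ` M" and ?Y = "y ` M"
  have cX: "card ?X = card M" by (rule card_image[OF injx])
  have finV: "finite (graph_nbrs H v)" for v by (rule finite_graph_nbrs[OF V H])
  have cover: "H \<subseteq> (\<Union>v\<in>?X. {e \<in> H. v \<in> e}) \<union> nsets ?Y 2 \<union> (\<Union>v\<in>?Y. (\<lambda>u. {v, u}) ` out v)"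
  proof
    fix e assume e: "e \<in> H"
    have hit: "e \<inter> \<Union>M \<noteq> {}"
    proof
      assume a: "e \<inter> \<Union>M = {}"
      have "card (insert e M) \<le> card M"
        using a e M by (intro max disjoint_insertI) auto
      moreover have "e \<noteq> {}" using e H by (auto simp: nsets_def)
      then have "e \<notin> M" using a by blast
      ultimately show False using finM by simp
    qed
    show "e \<in> (\<Union>v\<in>?X. {e \<in> H. v \<in> e}) \<union> nsets ?Y 2 \<union> (\<Union>v\<in>?Y. (\<lambda>u. {v, u}) ` out v)"
    proof (cases "e \<inter> ?X = {}")
      case False
      then show ?thesis using e by blast
    next
      case True
      obtain v where v: "v \<in> e" "v \<in> \<Union>M" using hit by blast
      with True MXY have vY: "v \<in> ?Y" by blast
      obtain u where u: "e = {v, u}" "u \<in> graph_nbrs H v"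
        using edges_at_eq_image[OF H, of v] e v(1) by blast
      then have uv: "u \<noteq> v" using graph_nbrs_subset[OF H, of v] by auto
      show ?thesis
      proof (cases "u \<in> \<Union>M")
        case True
        then have "u \<in> ?Y" using MXY \<open>e \<inter> ?X = {}\<close> u by blast
        then have "e \<in> nsets ?Y 2" using u uv vY by (auto simp: nsets_def)
        then show ?thesis by blast
      next
        case False
        then have "e \<in> (\<lambda>u. {v, u}) ` out v" using u by (auto simp: out_def)
        then show ?thesis using vY by blast
      qed
    qed
  qed
  have finout: "finite (out v)" for v using finV by (simp add: out_def)
  have "card H \<le> card ((\<Union>v\<in>?X. {e \<in> H. v \<in> e}) \<union> nsets ?Y 2 \<union> (\<Union>v\<in>?Y. (\<lambda>u. {v, u}) ` out v))"
    using cover finM finH finout by (intro card_mono) (auto simp: finite_imp_finite_nsets)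
  also have "\<dots> \<le> card (\<Union>v\<in>?X. {e \<in> H. v \<in> e}) + card (nsets ?Y 2)
      + card (\<Union>v\<in>?Y. (\<lambda>u. {v, u}) ` out v)"
    by (meson add_right_mono card_Un_le order_trans)
  also have "card (\<Union>v\<in>?X. {e \<in> H. v \<in> e}) \<le> (\<Sum>v\<in>?X. card {e \<in> H. v \<in> e})"
    by (intro card_UN_le) (use finM in auto)
  also have "\<dots> = (\<Sum>v\<in>?X. card (graph_nbrs H v))" by (simp add: card_edges_at[OF H])
  also have "card (nsets ?Y 2) \<le> card ?X choose 2"
    unfolding card_nsets cX by (intro binomial_right_mono card_image_le finM)
  also have "card (\<Union>v\<in>?Y. (\<lambda>u. {v, u}) ` out v) \<le> (\<Sum>v\<in>?Y. card ((\<lambda>u. {v, u}) ` out v))"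
    by (intro card_UN_le) (use finM in auto)
  also have "\<dots> \<le> (\<Sum>v\<in>?Y. 1)"
  proof (rule sum_mono)
    fix v assume "v \<in> ?Y"
    then have "card (out v) \<le> 1" using xy by auto
    then show "card ((\<lambda>u. {v, u}) ` out v) \<le> 1"
      using card_image_le[OF finout] order_trans by blast
  qed
  also have "\<dots> \<le> card ?X" using card_image_le[OF finM, of y] by (simp add: cX)
  finally have "card H \<le> (\<Sum>v\<in>?X. card (graph_nbrs H v)) + (card ?X choose 2) + card ?X" by simp
  moreover have "?X \<subseteq> V"
  proof
    fix v assume "v \<in> ?X"
    then obtain e where "e \<in> M" "v \<in> e" using xy by blast
    then show "v \<in> V" using M(1) H by (auto simp: nsets_def)
  qed
  moreover have "card ?X \<le> m" unfolding cX by (rule small[OF M])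
  ultimately show ?thesis by (rule that[rotated 2])
qed

text \<open>Members supplied by the hypothesis are removed one at a time. With \<open>j\<close>
  members left, the next one has value at most \<open>t - j\<close>, and the sum of
  \<open>t - j\<close> over \<open>j = 1, ..., card X\<close> is half of the right-hand
  side.\<close>

lemma sum_le_of_small_member_in_subsets:
  fixes f :: "'a \<Rightarrow> int"
  assumes "finite X" and "\<And>Y. Y \<subseteq> X \<Longrightarrow> Y \<noteq> {} \<Longrightarrow> \<exists>y\<in>Y. f y + int (card Y) \<le> t"
  shows "2 * sum f X \<le> int (card X) * (2 * t - 1 - int (card X))"
  using assms
proof (induction "card X" arbitrary: X)
  case 0
  then show ?case by simp
next
  case (Suc m)
  then have "X \<noteq> {}" by auto
  with Suc.prems obtain y where y: "y \<in> X" "f y + int (card X) \<le> t" by blast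
  have c: "card (X - {y}) = m" using Suc.hyps(2) y Suc.prems(1) by simp
  have "2 * sum f (X - {y}) \<le> int m * (2 * t - 1 - int m)"
    unfolding c[symmetric]
  proof (rule Suc.hyps(1))
    show "\<exists>y\<in>Y. f y + int (card Y) \<le> t" if "Y \<subseteq> X - {y}" "Y \<noteq> {}" for Y
      using that by (intro Suc.prems(2)) auto
  qed (use Suc.prems c in auto)
  moreover have "sum f X = f y + sum f (X - {y})"
    using y(1) Suc.prems(1) by (rule sum.remove[rotated])
  moreover have "int (card X) = int m + 1" using Suc.hyps(2) by simp
  ultimately show ?case using y(2) by (simp add: algebra_simps)
qed

section \<open>Triple systems without a large packing\<close>

text \<open>The packing argument does not involve colors: \<open>R\<close> stands for the set of
  rainbow triangles, and a packing is a disjoint subfamily of \<open>R\<close>.\<close>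

locale triple_system =
  fixes V :: "'a set" and R :: "'a set set"
  assumes finite_V: "finite V" and triples: "R \<subseteq> nsets V 3"
begin

text \<open>For a pair \<open>e\<close>, the size of this set is the number of triples containing
  \<open>e\<close>: a member of \<open>e\<close> never qualifies, as inserting it gives back a set
  of two elements.\<close>

definition thirds :: "'a set \<Rightarrow> 'a set" where
  "thirds e = {w. insert w e \<in> R}"

text \<open>The threshold \<open>3k - 2\<close>, written without subtraction, is the least one for which a heavy pair
  extends to a triple avoiding any \<open>k - 1\<close> given triples.\<close>

definition heavy :: "nat \<Rightarrow> 'a set set" where
  "heavy k = {e \<in> nsets V 2. 3 * k \<le> card (thirds e) + 2}"

lemma finite_R: "finite R"
  using triples finite_V by (meson finite_imp_finite_nsets finite_subset)

lemma thirds_subset: "card e = 2 \<Longrightarrow> thirds e \<subseteq> V - e"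
proof
  fix w assume "card e = 2" "w \<in> thirds e"
  moreover from this have "insert w e \<in> nsets V 3" using triples by (auto simp: thirds_def)
  ultimately show "w \<in> V - e" by (auto simp: nsets_def card_insert_if split: if_splits)
qed

lemma finite_thirds: "card e = 2 \<Longrightarrow> finite (thirds e)"
  by (meson finite_Diff finite_V finite_subset thirds_subset)

lemma heavy_subset: "heavy k \<subseteq> nsets V 2"
  by (auto simp: heavy_def)

lemma card_Union_packing: "F \<subseteq> R \<Longrightarrow> disjoint F \<Longrightarrow> card (\<Union>F) = 3 * card F"
  by (rule card_Union_nsets) (use triples finite_R finite_subset in auto)

lemma triple_subset: "T \<in> R \<Longrightarrow> T \<subseteq> V" and card_triple: "T \<in> R \<Longrightarrow> card T = 3"
  using triples by (auto simp: nsets_def)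

lemma finite_Union_packing: "F \<subseteq> R \<Longrightarrow> finite (\<Union>F)"
  using triple_subset by (intro finite_subset[OF _ finite_V]) blast

lemma finite_Union_pairs: "M \<subseteq> nsets V 2 \<Longrightarrow> finite (\<Union>M)"
  by (intro finite_subset[OF _ finite_V]) (auto simp: nsets_def)

section \<open>Greedy extension of packings\<close>

lemma insert_packing:
  assumes "F \<subseteq> R" "disjoint F" "T \<in> R" "T \<inter> \<Union>F = {}"
  shows "disjoint (insert T F)" "card (insert T F) = Suc (card F)"
proof -
  show "disjoint (insert T F)" using assms by (intro disjoint_insertI) auto
  have "T \<noteq> {}" using card_triple[OF assms(3)] by auto
  then have "T \<notin> F" using assms(4) by auto
  then show "card (insert T F) = Suc (card F)"
    using assms(1) finite_R finite_subset by (metis card_insert_disjoint)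
qed

text \<open>The pairs are completed to triples one after another. The third vertex has to avoid at
  most \<open>3 * card F + 2 * (card M - 1)\<close> vertices, which is at most
  \<open>3 * k - 3\<close> because \<open>card F + card M \<le> k\<close>; a heavy pair therefore
  always has a choice left.\<close>

lemma packing_extend_matching:
  assumes "F \<subseteq> R" "disjoint F" "M \<subseteq> heavy k" "disjoint M" "\<Union>F \<inter> \<Union>M = {}"
    and "card F + card M \<le> k"
  shows "\<exists>F'\<subseteq>R. disjoint F' \<and> card F' = card F + card M"
  using assms
proof (induction "card M" arbitrary: F M)
  case 0
  then show ?case by auto
next
  case (Suc m)
  have finM: "finite M" using Suc.hyps(2) card.infinite by fastforce
  obtain e where e: "e \<in> M" using Suc.hyps(2) by fastforce
  let ?M = "M - {e}"
  have cM: "card ?M = m" using Suc.hyps(2) e finM by simp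
  have M2: "M \<subseteq> nsets V 2" using Suc.prems(3) heavy_subset by blast
  have dM: "disjoint ?M" using Suc.prems(4) by (auto simp: disjoint_def)
  have e2: "card e = 2" using e M2 by (auto simp: nsets_def)
  have eM: "e \<inter> \<Union>?M = {}" using Suc.prems(4) e by (auto simp: disjoint_def)
  have "card (\<Union>?M) = 2 * m"
    using card_Union_nsets[OF _ _ dM] finM M2 cM by auto
  then have "card (\<Union>F \<union> \<Union>?M) \<le> 3 * card F + 2 * m"
    using card_Un_le[of "\<Union>F" "\<Union>?M"] card_Union_packing[OF Suc.prems(1,2)] by simp
  moreover have "3 * k \<le> card (thirds e) + 2" using Suc.prems(3) e by (auto simp: heavy_def)
  moreover have "card F + Suc m \<le> k" using Suc by simp
  ultimately have "card (\<Union>F \<union> \<Union>?M) < card (thirds e)" by simp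
  moreover have "finite (\<Union>F \<union> \<Union>?M)"
    using finite_Union_packing[OF Suc.prems(1)] finite_Union_pairs[of ?M] M2 by blast
  ultimately have "\<not> thirds e \<subseteq> \<Union>F \<union> \<Union>?M"
    by (meson card_mono not_less)
  then obtain w where w: "w \<in> thirds e" "w \<notin> \<Union>F" "w \<notin> \<Union>?M" by blast
  have "e \<inter> \<Union>F = {}" using e Suc.prems(5) by blast
  with w have T: "insert w e \<in> R" "insert w e \<inter> \<Union>F = {}"
    by (simp_all add: thirds_def)
  note ins = insert_packing[OF Suc.prems(1,2) T]
  have "\<exists>F'\<subseteq>R. disjoint F' \<and> card F' = card (insert (insert w e) F) + card ?M"
  proof (rule Suc.hyps(1))
    show "\<Union>(insert (insert w e) F) \<inter> \<Union>?M = {}" using w(3) eM Suc.prems(5) by blast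
    show "card (insert (insert w e) F) + card ?M \<le> k"
      using ins(2) cM Suc.hyps(2) Suc.prems(6) by simp
    show "insert (insert w e) F \<subseteq> R" "?M \<subseteq> heavy k" using T(1) Suc.prems(1,3) by auto
  qed (fact cM[symmetric] dM ins(1))+
  moreover have "card (insert (insert w e) F) + card ?M = card F + card M"
    using ins(2) cM Suc.hyps(2) by linarith
  ultimately show ?case by metis
qed

text \<open>Each \<open>b\<close> in \<open>B\<close> is joined to a fresh heavy neighbor and the
  resulting pair moves to \<open>M\<close>, until only a matching of heavy pairs remains to be
  completed. The weights in the degree condition are chosen so that trading a vertex of
  \<open>B\<close> for a pair of \<open>M\<close> leaves its left side unchanged.\<close>

lemma packing_extend_stars:
  assumes "F \<subseteq> R" "disjoint F" "M \<subseteq> heavy k" "disjoint M" "finite B"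
    and "\<Union>F \<inter> \<Union>M = {}" "\<Union>F \<inter> B = {}" "\<Union>M \<inter> B = {}"
    and "card F + card M + card B \<le> k"
    and "\<And>b. b \<in> B \<Longrightarrow> 3 * card F + 2 * card M + 2 * card B \<le> card (graph_nbrs (heavy k) b) + 1"
  shows "\<exists>F'\<subseteq>R. disjoint F' \<and> card F' = card F + card M + card B"
  using assms
proof (induction "card B" arbitrary: M B)
  case 0
  then show ?case using packing_extend_matching[of F M k] by auto
next
  case (Suc m)
  obtain b where b: "b \<in> B" using Suc.hyps(2) by fastforce
  let ?B = "B - {b}"
  let ?N = "graph_nbrs (heavy k) b"
  have cB: "card ?B = m" using Suc.hyps(2) b Suc.prems(5) by simp
  have M2: "M \<subseteq> nsets V 2" using Suc.prems(3) heavy_subset by blast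
  have finM: "finite M" using M2 finite_V by (meson finite_imp_finite_nsets finite_subset)
  have "card (\<Union>M) = 2 * card M"
    using card_Union_nsets[OF finM M2 Suc.prems(4)] .
  then have "card (\<Union>F \<union> \<Union>M \<union> ?B) \<le> 3 * card F + 2 * card M + m"
    using card_Un_le[of "\<Union>F" "\<Union>M"] card_Un_le[of "\<Union>F \<union> \<Union>M" ?B]
      card_Union_packing[OF Suc.prems(1,2)] cB by simp
  moreover have "3 * card F + 2 * card M + 2 * Suc m \<le> card ?N + 1"
    using Suc.prems(10)[OF b] Suc.hyps(2) by simp
  ultimately have "card (\<Union>F \<union> \<Union>M \<union> ?B) < card ?N" by simp
  moreover have "finite (\<Union>F \<union> \<Union>M \<union> ?B)"
    using finite_Union_packing[OF Suc.prems(1)] finite_Union_pairs[OF M2] Suc.prems(5) by blast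
  ultimately have "\<not> ?N \<subseteq> \<Union>F \<union> \<Union>M \<union> ?B"
    by (meson card_mono not_less)
  then obtain u where u: "u \<in> ?N" "u \<notin> \<Union>F" "u \<notin> \<Union>M" "u \<notin> ?B" by blast
  have ub: "u \<noteq> b" using u(1) graph_nbrs_subset[OF heavy_subset] by blast
  have "{b, u} \<notin> M" using u(3) by blast
  then have cM: "card (insert {b, u} M) = Suc (card M)" using finM by simp
  have dM: "disjoint (insert {b, u} M)"
    by (rule disjoint_insertI[OF Suc.prems(4)]) (use u b Suc.prems(8) in blast)
  have "\<exists>F'\<subseteq>R. disjoint F' \<and> card F' = card F + card (insert {b, u} M) + card ?B"
  proof (rule Suc.hyps(1))
    show "insert {b, u} M \<subseteq> heavy k" using Suc.prems(3) u by (auto simp: graph_nbrs_def)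
    show "\<Union>F \<inter> \<Union>(insert {b, u} M) = {}" using u(2) b Suc.prems(6,7) by blast
    show "\<Union>(insert {b, u} M) \<inter> ?B = {}" using u(4) ub Suc.prems(8) by blast
    show "card F + card (insert {b, u} M) + card ?B \<le> k"
      using Suc.prems(9) cM cB Suc.hyps(2) by simp
    show "3 * card F + 2 * card (insert {b, u} M) + 2 * card ?B
      \<le> card (graph_nbrs (heavy k) a) + 1" if "a \<in> ?B" for a
      using Suc.prems(10)[of a] that cM cB Suc.hyps(2) by simp
    show "\<Union>F \<inter> ?B = {}" using Suc.prems(7) by blast
    show "finite ?B" using Suc.prems(5) by simp
  qed (fact Suc.prems(1,2) cB[symmetric] dM)+
  moreover have "card F + card (insert {b, u} M) + card ?B = card F + card M + card B"
    using cM cB Suc.hyps(2) by linarith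
  ultimately show ?case by metis
qed

text \<open>The hypothesis on \<open>B\<close> below is what induction on \<open>k\<close> provides. The bound follows by charging
  each triple to a heavy pair it contains or, if it has none, to one of the \<open>3(k - 1)\<close> vertices of
  a maximal packing.\<close>

lemma card_triples_le:
  assumes "k > 0" "V \<noteq> {}" "3 * k \<le> card V"
    and none: "\<And>F. F \<subseteq> R \<Longrightarrow> disjoint F \<Longrightarrow> card F \<noteq> k"
    and avoid: "\<And>B. B \<subseteq> V \<Longrightarrow> B \<noteq> {} \<Longrightarrow> card B \<le> k \<Longrightarrow>
      \<exists>F\<subseteq>R. disjoint F \<and> card F = k - card B \<and> \<Union>F \<inter> B = {}"
  shows "int (card R) \<le> (int k - 1) * (3 * int k - 2) * (int (card V) - 3 * int k + 1)
    + 27 * (int k - 1) ^ 3"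
proof -
  let ?H = "heavy k"
  let ?N = "graph_nbrs ?H"
  have H2: "?H \<subseteq> nsets V 2" by (rule heavy_subset)
  have finH: "finite ?H" using H2 finite_V by (meson finite_imp_finite_nsets finite_subset)
  \<comment> \<open>Otherwise all heavy degrees in \<open>B\<close> are at least
    \<open>3 * k - 1 - card B\<close>. This is just enough to extend a packing of
    \<open>k - card B\<close> triples avoiding \<open>B\<close> by one triple for each vertex of
    \<open>B\<close>, to the forbidden size \<open>k\<close>.\<close>
  have degree_bound: "\<exists>b\<in>B. int (card (?N b)) + int (card B) \<le> 3 * int k - 2"
    if B: "B \<subseteq> V" "B \<noteq> {}" "card B \<le> k" for B
  proof (rule ccontr)
    assume neg: "\<not> ?thesis"
    obtain F where F: "F \<subseteq> R" "disjoint F" "card F = k - card B" "\<Union>F \<inter> B = {}"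
      using avoid[OF B] by blast
    have "\<exists>F'\<subseteq>R. disjoint F' \<and> card F' = card F + card ({} :: 'a set set) + card B"
    proof (rule packing_extend_stars)
      show "finite B" using B(1) finite_V finite_subset by blast
      show "3 * card F + 2 * card ({} :: 'a set set) + 2 * card B \<le> card (?N b) + 1" if "b \<in> B" for b
      proof -
        have "\<not> int (card (?N b)) + int (card B) \<le> 3 * int k - 2" using neg that by blast
        then show ?thesis using F(3) B(3) by simp
      qed
      show "card F + card ({} :: 'a set set) + card B \<le> k" using F(3) B(3) by simp
    qed (simp_all add: F(1,2,4))
    then obtain F' where "F' \<subseteq> R" "disjoint F'" "card F' = card F + card B" by auto
    with none[of F'] F(3) B(3) show False by simp
  qed
  \<comment> \<open>Starting from the empty packing, \<open>k\<close> disjoint heavy pairs would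
    extend to \<open>k\<close> disjoint triples.\<close>
  have small_matching: "card M \<le> k - 1" if M: "M \<subseteq> ?H" "disjoint M" for M
  proof (rule ccontr)
    assume "\<not> card M \<le> k - 1"
    then have "k \<le> card M" by simp
    then obtain M' where M': "M' \<subseteq> M" "card M' = k"
      using obtain_subset_with_card_n by metis
    have "disjoint M'" using M(2) M'(1) by (auto simp: disjoint_def)
    then show False
      using packing_extend_matching[of "{}" M'] none M(1) M' by fastforce
  qed
  obtain X where X: "X \<subseteq> V" "card X \<le> k - 1"
      "card ?H \<le> (\<Sum>x\<in>X. card (?N x)) + (card X choose 2) + card X"
    using edge_count_via_maximum_matching[OF finite_V H2, of "k - 1"] small_matching by metis
  have finX: "finite X" using X(1) finite_V finite_subset by blast
  have "2 * (\<Sum>x\<in>X. int (card (?N x))) \<le> int (card X) * (2 * (3 * int k - 2) - 1 - int (card X))"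
  proof (rule sum_le_of_small_member_in_subsets[OF finX])
    fix Y assume "Y \<subseteq> X" "Y \<noteq> {}"
    moreover have "card Y \<le> card X" using card_mono[OF finX] calculation(1) .
    ultimately show "\<exists>y\<in>Y. int (card (?N y)) + int (card Y) \<le> 3 * int k - 2"
      using X(1,2) by (intro degree_bound) (blast, blast, linarith)
  qed
  moreover have "2 * int (card X choose 2) = int (card X) * (int (card X) - 1)"
  proof -
    have "2 * (card X choose 2) = card X * (card X - 1)"
      using times_binomial_minus1_eq[of 2 "card X"] by simp
    then show ?thesis by (cases "card X") (auto simp: algebra_simps simp flip: of_nat_mult)
  qed
  moreover have "2 * int (card ?H) \<le> 2 * (\<Sum>x\<in>X. int (card (?N x))) + 2 * int (card X choose 2) + 2 * int (card X)"
    using X(3) by (simp flip: of_nat_sum)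
  \<comment> \<open>The quadratic terms cancel: with \<open>x = card X\<close>, the bound is
    \<open>x * (6 * k - 5 - x) + x * (x - 1) + 2 * x = x * (6 * k - 4)\<close>.\<close>
  ultimately have "2 * int (card ?H) \<le> 2 * (int (card X) * (3 * int k - 2))"
    by (simp add: algebra_simps)
  also have "\<dots> \<le> 2 * ((int k - 1) * (3 * int k - 2))"
    using X(2) assms(1) by (intro mult_left_mono mult_right_mono) auto
  finally have cH: "int (card ?H) \<le> (int k - 1) * (3 * int k - 2)" by simp

  \<comment> \<open>Avoiding a single vertex already yields a packing of \<open>k - 1\<close>
    triples. No larger one exists, so every triple and every heavy pair meets its vertex set
    \<open>S\<close>.\<close>
  obtain v0 where v0: "v0 \<in> V" using assms(2) by blast
  obtain F0 where F0: "F0 \<subseteq> R" "disjoint F0" "card F0 = k - 1"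
    using avoid[of "{v0}"] v0 assms(1) by fastforce
  define S where "S = \<Union>F0"
  have finS: "finite S" unfolding S_def by (rule finite_Union_packing[OF F0(1)])
  have cS: "card S = 3 * (k - 1)" using card_Union_packing[OF F0(1,2)] F0(3) by (simp add: S_def)
  have SV: "S \<subseteq> V" using F0(1) triple_subset unfolding S_def by blast
  have extend: "T \<inter> \<Union>F \<noteq> {}" if "T \<in> R" "F \<subseteq> R" "disjoint F" "card F = k - 1" for T F
  proof
    assume "T \<inter> \<Union>F = {}"
    note insert_packing[OF that(2,3,1) this]
    moreover have "insert T F \<subseteq> R" using that(1,2) by simp
    ultimately show False using none[of "insert T F"] that(4) assms(1) by simp
  qed
  have extend_heavy: "e \<inter> \<Union>F \<noteq> {}"
    if "e \<in> ?H" "F \<subseteq> R" "disjoint F" "card F = k - 1" for e F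
  proof
    assume "e \<inter> \<Union>F = {}"
    then have "\<exists>F'\<subseteq>R. disjoint F' \<and> card F' = card F + card {e}"
      using that assms(1) by (intro packing_extend_matching[where k = k]) auto
    then show False using none that(4) assms(1) by fastforce
  qed

  define L where "L = {T \<in> R. nsets T 2 \<inter> ?H = {}}"
  \<comment> \<open>Here the packing of \<open>k - 1\<close> triples is chosen to avoid
    \<open>s\<close>, so that its vertex set contains all heavy neighbors of \<open>s\<close>. A
    triple of \<open>L\<close> through \<open>s\<close> meets this vertex set in some
    \<open>u\<close> that is not a heavy neighbor, and the light pair \<open>{s, u}\<close> has at
    most \<open>3 * k - 3\<close> completions.\<close>
  have L_at: "int (card {T \<in> L. s \<in> T}) \<le> (3 * int k - 3) * (3 * int k - 3 - int (card (?N s)))"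
    if s: "s \<in> V" for s
  proof -
    obtain F where F: "F \<subseteq> R" "disjoint F" "card F = k - 1" "\<Union>F \<inter> {s} = {}"
      using avoid[of "{s}"] s assms(1) by fastforce
    let ?U = "\<Union>F - ?N s"
    have finF: "finite (\<Union>F)" by (rule finite_Union_packing[OF F(1)])
    have N: "?N s \<subseteq> \<Union>F"
    proof
      fix u assume "u \<in> ?N s"
      then have "{s, u} \<inter> \<Union>F \<noteq> {}" using F by (intro extend_heavy) (auto simp: graph_nbrs_def)
      then show "u \<in> \<Union>F" using F(4) by auto
    qed
    have light: "card (thirds {s, u}) \<le> 3 * k - 3" if "u \<in> ?U" for u
    proof -
      have "u \<noteq> s" "u \<in> V" using that F(1,4) triple_subset by blast+
      then have "{s, u} \<in> nsets V 2" using s by simp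
      with that show ?thesis by (auto simp: heavy_def graph_nbrs_def)
    qed
    have "{T \<in> L. s \<in> T} \<subseteq> (\<Union>u\<in>?U. (\<lambda>w. {w, s, u}) ` thirds {s, u})"
    proof
      fix T assume "T \<in> {T \<in> L. s \<in> T}"
      then have T: "T \<in> R" "s \<in> T" "nsets T 2 \<inter> ?H = {}" by (auto simp: L_def)
      obtain u where u: "u \<in> T" "u \<in> \<Union>F" using extend[OF T(1) F(1-3)] by blast
      then have us: "u \<noteq> s" using F(4) by auto
      have "{s, u} \<in> nsets T 2" using T(2) u us by simp
      then have "u \<notin> ?N s" using T(3) unfolding graph_nbrs_def by blast
      have "card (T - {s, u}) = 1"
        using card_triple[OF T(1)] T(2) u(1) us by (subst card_Diff_subset) auto
      then obtain w where "T - {s, u} = {w}" using card_1_singletonE by blast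
      then have "T = {w, s, u}" using T(2) u by auto
      then have "T \<in> (\<lambda>w. {w, s, u}) ` thirds {s, u}" using T(1) by (auto simp: thirds_def)
      then show "T \<in> (\<Union>u\<in>?U. (\<lambda>w. {w, s, u}) ` thirds {s, u})"
        using u \<open>u \<notin> ?N s\<close> by blast
    qed
    moreover have fint: "finite (thirds {s, u})" if "u \<in> ?U" for u
    proof (rule finite_thirds)
      have "u \<noteq> s" using that F(4) by blast
      then show "card {s, u} = 2" by simp
    qed
    ultimately have "card {T \<in> L. s \<in> T} \<le> card (\<Union>u\<in>?U. (\<lambda>w. {w, s, u}) ` thirds {s, u})"
      using finF by (intro card_mono) auto
    also have "\<dots> \<le> (\<Sum>u\<in>?U. card ((\<lambda>w. {w, s, u}) ` thirds {s, u}))"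
      using finF by (intro card_UN_le) auto
    also have "\<dots> \<le> (\<Sum>u\<in>?U. 3 * k - 3)"
      using light fint card_image_le order_trans by (intro sum_mono) blast
    also have "\<dots> = card ?U * (3 * k - 3)" by simp
    finally have "int (card {T \<in> L. s \<in> T}) \<le> int (card ?U) * int (3 * k - 3)"
      by (metis of_nat_le_iff of_nat_mult)
    moreover have "card ?U = card (\<Union>F) - card (?N s)"
      using N finF finite_subset[OF N finF] by (intro card_Diff_subset)
    moreover have "card (?N s) \<le> card (\<Union>F)" using N finF card_mono by blast
    moreover have "card (\<Union>F) = 3 * k - 3" using card_Union_packing[OF F(1,2)] F(3) by simp
    ultimately have "int (card ?U) = 3 * int k - 3 - int (card (?N s))" "int (3 * k - 3) = 3 * int k - 3"
      using assms(1) by linarith+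
    with \<open>int (card {T \<in> L. s \<in> T}) \<le> int (card ?U) * int (3 * k - 3)\<close>
    show ?thesis by (simp add: mult.commute)
  qed

  have "R \<subseteq> (\<Union>e\<in>?H. (\<lambda>w. insert w e) ` thirds e) \<union> L"
  proof
    fix T assume T: "T \<in> R"
    show "T \<in> (\<Union>e\<in>?H. (\<lambda>w. insert w e) ` thirds e) \<union> L"
    proof (cases "T \<in> L")
      case False
      then obtain e where "e \<in> ?H" "e \<in> nsets T 2" using T unfolding L_def by blast
      then have e: "e \<in> ?H" "e \<subseteq> T" "card e = 2" by (simp_all add: nsets_def)
      have "card (T - e) = 1"
        using card_triple[OF T] e by (subst card_Diff_subset) (auto intro: card_ge_0_finite)
      then obtain w where "T - e = {w}" using card_1_singletonE by blast
      then have "T = insert w e" using e(2) by auto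
      then have "T \<in> (\<lambda>w. insert w e) ` thirds e" using T by (auto simp: thirds_def)
      then show ?thesis using e(1) by blast
    qed blast
  qed
  moreover have "L \<subseteq> R" by (auto simp: L_def)
  then have finL: "finite L" using finite_R finite_subset by blast
  moreover have H_card: "card e = 2" if "e \<in> ?H" for e using that H2 by (auto simp: nsets_def)
  ultimately have "card R \<le> card ((\<Union>e\<in>?H. (\<lambda>w. insert w e) ` thirds e) \<union> L)"
    using finH finite_thirds by (intro card_mono) auto
  also have "\<dots> \<le> card (\<Union>e\<in>?H. (\<lambda>w. insert w e) ` thirds e) + card L" by (rule card_Un_le)
  also have "card (\<Union>e\<in>?H. (\<lambda>w. insert w e) ` thirds e)
      \<le> (\<Sum>e\<in>?H. card ((\<lambda>w. insert w e) ` thirds e))"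
    using finH by (rule card_UN_le)
  also have "\<dots> \<le> (\<Sum>e\<in>?H. card V - 2)"
  proof (rule sum_mono)
    fix e assume e: "e \<in> ?H"
    have "card ((\<lambda>w. insert w e) ` thirds e) \<le> card (thirds e)"
      using finite_thirds H_card e by (intro card_image_le) auto
    also have "\<dots> \<le> card (V - e)"
      using thirds_subset H_card e finite_V by (intro card_mono) auto
    also have "\<dots> = card V - 2"
      using e H2 H_card[OF e] by (subst card_Diff_subset) (auto simp: nsets_def)
    finally show "card ((\<lambda>w. insert w e) ` thirds e) \<le> card V - 2" .
  qed
  also have "\<dots> = card ?H * (card V - 2)" by simp
  finally have "int (card R) \<le> int (card ?H * (card V - 2) + card L)"
    by (simp only: of_nat_le_iff)
  also have "\<dots> = int (card ?H) * int (card V - 2) + int (card L)" by simp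
  also have "int (card V - 2) = int (card V) - 2" using assms(1,3) by linarith
  finally have R1: "int (card R) \<le> int (card ?H) * (int (card V) - 2) + int (card L)" .

  have "L \<subseteq> (\<Union>s\<in>S. {T \<in> L. s \<in> T})"
  proof
    fix T assume T: "T \<in> L"
    with \<open>L \<subseteq> R\<close> have "T \<in> R" by blast
    then have "T \<inter> S \<noteq> {}" unfolding S_def by (rule extend[OF _ F0])
    with T show "T \<in> (\<Union>s\<in>S. {T \<in> L. s \<in> T})" by blast
  qed
  then have "card L \<le> card (\<Union>s\<in>S. {T \<in> L. s \<in> T})"
    using finL finS by (intro card_mono) auto
  also have "\<dots> \<le> (\<Sum>s\<in>S. card {T \<in> L. s \<in> T})" using finS by (rule card_UN_le)
  finally have "int (card L) \<le> (\<Sum>s\<in>S. int (card {T \<in> L. s \<in> T}))"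
    by (metis of_nat_le_iff of_nat_sum)
  also have "\<dots> \<le> (\<Sum>s\<in>S. (3 * int k - 3) * (3 * int k - 3 - int (card (?N s))))"
    using SV by (intro sum_mono L_at) auto
  also have "\<dots> = (3 * int k - 3) * ((3 * int k - 3) * (3 * int k - 3) - (\<Sum>s\<in>S. int (card (?N s))))"
    using cS assms(1) by (simp add: sum_distrib_left[symmetric] sum_subtractf of_nat_diff right_diff_distrib)
  finally have L1: "int (card L) \<le> (3 * int k - 3) *
    ((3 * int k - 3) * (3 * int k - 3) - (\<Sum>s\<in>S. int (card (?N s))))" .

  \<comment> \<open>The degree sum subtracted in the bound for \<open>L\<close> is at least
    \<open>card ?H\<close>. Each heavy pair thus saves \<open>3 * k - 3\<close> light triples, which
    lowers its net contribution from \<open>card V - 2\<close> to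
    \<open>card V - 3 * k + 1\<close>.\<close>
  have "?H \<subseteq> (\<Union>s\<in>S. {e \<in> ?H. s \<in> e})"
  proof
    fix e assume e: "e \<in> ?H"
    then have "e \<inter> S \<noteq> {}" unfolding S_def by (rule extend_heavy[OF _ F0])
    with e show "e \<in> (\<Union>s\<in>S. {e \<in> ?H. s \<in> e})" by blast
  qed
  then have "card ?H \<le> card (\<Union>s\<in>S. {e \<in> ?H. s \<in> e})"
    using finH finS by (intro card_mono) auto
  also have "\<dots> \<le> (\<Sum>s\<in>S. card {e \<in> ?H. s \<in> e})" using finS by (rule card_UN_le)
  also have "\<dots> = (\<Sum>s\<in>S. card (?N s))" by (simp add: card_edges_at[OF H2])
  finally have "int (card ?H) \<le> (\<Sum>s\<in>S. int (card (?N s)))"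
    by (metis of_nat_le_iff of_nat_sum)
  then have "(3 * int k - 3) * int (card ?H) \<le> (3 * int k - 3) * (\<Sum>s\<in>S. int (card (?N s)))"
    using assms(1) by (intro mult_left_mono) auto
  with R1 L1 have "int (card R) \<le> int (card ?H) * (int (card V) - 3 * int k + 1) + 27 * (int k - 1) ^ 3"
    by (simp add: algebra_simps power3_eq_cube)
  also have "int (card ?H) * (int (card V) - 3 * int k + 1)
      \<le> (int k - 1) * (3 * int k - 2) * (int (card V) - 3 * int k + 1)"
    using cH assms(3) by (intro mult_right_mono) auto
  finally show ?thesis by simp
qed

end

section \<open>The number of rainbow triangles\<close>

lemma card_pairs_same_value_le:
  assumes "finite N"
  shows "int (card {(u, w). u \<in> N \<and> w \<in> N \<and> u \<noteq> w \<and> f u = f w})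
    \<le> (int (card N) - int (card (f ` N))) * (int (card N) - int (card (f ` N)) + 1)"
proof -
  define F where "F = (\<lambda>b. {u \<in> N. f u = b})"
  define x where "x = card N - card (f ` N)"
  have finF: "finite (F b)" for b using assms by (simp add: F_def)
  have pos: "card (F b) \<ge> 1" if "b \<in> f ` N" for b
    using that finF[of b] by (auto simp: F_def Suc_le_eq card_gt_0_iff)
  have "card N = (\<Sum>b\<in>f ` N. card (F b))"
    using sum.image_gen[OF assms, of "\<lambda>_. 1::nat" f] by (simp add: F_def)
  also have "\<dots> = (\<Sum>b\<in>f ` N. (card (F b) - 1) + 1)"
    using le_add_diff_inverse2[OF pos] by (intro sum.cong refl) metis
  also have "\<dots> = (\<Sum>b\<in>f ` N. card (F b) - 1) + card (f ` N)"
    by (subst sum.distrib) simp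
  finally have x: "(\<Sum>b\<in>f ` N. card (F b) - 1) = x" by (simp add: x_def)
  have "{(u, w). u \<in> N \<and> w \<in> N \<and> u \<noteq> w \<and> f u = f w}
      \<subseteq> (\<Union>b\<in>f ` N. SIGMA u:F b. F b - {u})"
    by (auto simp: F_def)
  then have "card {(u, w). u \<in> N \<and> w \<in> N \<and> u \<noteq> w \<and> f u = f w}
      \<le> card (\<Union>b\<in>f ` N. SIGMA u:F b. F b - {u})"
    using assms finF by (intro card_mono) auto
  also have "\<dots> \<le> (\<Sum>b\<in>f ` N. card (SIGMA u:F b. F b - {u}))"
    using assms by (intro card_UN_le) simp
  also have "\<dots> = (\<Sum>b\<in>f ` N. card (F b) * (card (F b) - 1))"
    using finF by (intro sum.cong) (simp_all add: card_SigmaI)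
  also have "\<dots> \<le> (\<Sum>b\<in>f ` N. (x + 1) * (card (F b) - 1))"
  proof (intro sum_mono mult_right_mono)
    fix b assume b: "b \<in> f ` N"
    then have "card (F b) - 1 \<le> (\<Sum>b\<in>f ` N. card (F b) - 1)"
      using assms by (intro member_le_sum) auto
    then show "card (F b) \<le> x + 1" using x by simp
  qed simp
  also have "\<dots> = (x + 1) * x" unfolding sum_distrib_left[symmetric] x ..
  finally have "int (card {(u, w). u \<in> N \<and> w \<in> N \<and> u \<noteq> w \<and> f u = f w}) \<le> int ((x + 1) * x)"
    by (rule of_nat_mono)
  moreover have "int x = int (card N) - int (card (f ` N))"
    using card_image_le[OF assms, of f] by (simp add: x_def)
  ultimately show ?thesis by (simp add: algebra_simps)
qed

lemma color_degree_eq: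
  assumes "E \<subseteq> nsets V 2"
  shows "color_degree E c v = card ((\<lambda>u. c {v, u}) ` graph_nbrs E v)"
  unfolding color_degree_def edges_at_eq_image[OF assms] by (simp add: image_image)

lemma card_ordered_triples_le:
  assumes "finite R" "R \<subseteq> nsets V 3" and P: "\<And>u v w. (u, v, w) \<in> P \<Longrightarrow> {u, v, w} \<in> R"
  shows "card P \<le> 6 * card R"
proof -
  define O' where "O' = (\<lambda>T. {(u, v, w). {u, v, w} = T} :: ('a \<times> 'a \<times> 'a) set)"
  have O: "finite (O' T) \<and> card (O' T) \<le> 6" if "T \<in> R" for T
  proof -
    from that assms(2) have "card T = 3" by (auto simp: nsets_def)
    then obtain a b d where T: "T = {a, b, d}" "a \<noteq> b" "a \<noteq> d" "b \<noteq> d"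
      by (auto simp: card_3_iff)
    let ?L = "[(a,b,d), (a,d,b), (b,a,d), (b,d,a), (d,a,b), (d,b,a)]"
    have "O' T \<subseteq> set ?L"
    proof
      fix p assume "p \<in> O' T"
      then obtain u v w where p: "p = (u, v, w)" "{u, v, w} = {a, b, d}" by (auto simp: O'_def T)
      then have "u \<in> {a, b, d}" "v \<in> {a, b, d}" "w \<in> {a, b, d}"
        "a \<in> {u, v, w}" "b \<in> {u, v, w}" "d \<in> {u, v, w}" by blast+
      then show "p \<in> set ?L" using T(2-) p(1) by auto
    qed
    moreover have "card (set ?L) \<le> 6" using card_length[of ?L] by simp
    ultimately show ?thesis by (meson List.finite_set card_mono finite_subset order_trans)
  qed
  have "P \<subseteq> (\<Union>T\<in>R. O' T)" using P by (auto simp: O'_def)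
  then have "card P \<le> card (\<Union>T\<in>R. O' T)"
    using O assms(1) by (intro card_mono) auto
  also have "\<dots> \<le> (\<Sum>T\<in>R. card (O' T))" using assms(1) by (rule card_UN_le)
  also have "\<dots> \<le> (\<Sum>T\<in>R. 6)" using O by (intro sum_mono) auto
  finally show ?thesis by simp
qed

text \<open>All ordered triangles are counted by \<open>d(u) + d(v) - n\<close> common neighbors per ordered edge; the
  non-rainbow ones contain two edges of the same color at a common vertex. Writing the degree of
  \<open>v\<close> as its color degree plus \<open>x\<close>, there are at most \<open>x (x + 1)\<close> ordered such pairs at \<open>v\<close>, and the
  \<open>x\<close> extra edges contribute more triangles than that.\<close>

lemma card_rainbow_triangles_ge:
  assumes V: "finite V" and E: "E \<subseteq> nsets V 2" and k: "k > 0" and n: "card V \<ge> 6"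
    and deg: "\<And>v. v \<in> V \<Longrightarrow> card V + k \<le> 2 * color_degree E c v"
  shows "int (card V) * int k * (int (card V) + int k)
    \<le> 12 * int (card {T. rainbow_triangle V E c T})"
proof -
  let ?n = "int (card V)"
  let ?R = "{T. rainbow_triangle V E c T}"
  define N where "N = graph_nbrs E"
  define d where "d = (\<lambda>v. int (card (N v)))"
  define D where "D = (\<lambda>v. int (color_degree E c v))"
  have finN: "finite (N v)" for v unfolding N_def by (rule finite_graph_nbrs[OF V E])
  have NV: "N v \<subseteq> V - {v}" for v unfolding N_def by (rule graph_nbrs_subset[OF E])
  have Nsym: "u \<in> N v \<longleftrightarrow> v \<in> N u" for u v by (simp add: N_def graph_nbrs_def insert_commute)
  have D_eq: "D v = int (card ((\<lambda>u. c {v, u}) ` N v))" for v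
    by (simp add: D_def color_degree_eq[OF E] N_def)
  \<comment> \<open>\<open>A\<close> consists of the ordered edges, and \<open>P\<close>, introduced
    below, of the ordered triangles, each stored as an ordered edge with a common neighbor of its
    ends.\<close>
  define A where "A = (SIGMA u:V. N u)"
  have finA: "finite A" unfolding A_def using V finN by auto
  define P where "P = (SIGMA p:A. N (fst p) \<inter> N (snd p))"
  have finP: "finite P" unfolding P_def using finA finN by auto
  have "(\<Sum>p\<in>A. d (fst p)) = (\<Sum>u\<in>V. \<Sum>v\<in>N u. d u)"
    unfolding A_def using V finN by (subst sum.Sigma) (auto simp: case_prod_unfold)
  then have s1: "(\<Sum>p\<in>A. d (fst p)) = (\<Sum>u\<in>V. d u * d u)" by (simp add: d_def)
  have "(\<Sum>p\<in>A. d (snd p)) = (\<Sum>p\<in>A. d (fst p))"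
  proof (rule sum.reindex_bij_witness[of _ prod.swap prod.swap])
    show "prod.swap p \<in> A" if "p \<in> A" for p
      using that Nsym NV by (cases p) (auto simp: A_def)
    then show "prod.swap p \<in> A" if "p \<in> A" for p using that by blast
  qed auto
  then have s2: "(\<Sum>p\<in>A. d (snd p)) = (\<Sum>u\<in>V. d u * d u)" using s1 by simp
  have s3: "int (card A) = (\<Sum>u\<in>V. d u)" unfolding A_def d_def using V finN by (simp add: card_SigmaI)
  have "(\<Sum>p\<in>A. d (fst p) + d (snd p) - ?n) \<le> (\<Sum>p\<in>A. int (card (N (fst p) \<inter> N (snd p))))"
  proof (rule sum_mono)
    fix p assume "p \<in> A"
    have "card (N (fst p) \<union> N (snd p)) \<le> card V"
      using NV V by (intro card_mono) blast+
    with card_Un_Int[OF finN finN, of "fst p" "snd p"]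
    show "d (fst p) + d (snd p) - ?n \<le> int (card (N (fst p) \<inter> N (snd p)))"
      by (simp add: d_def)
  qed
  also have "\<dots> = int (card P)" unfolding P_def using finA finN by (simp add: card_SigmaI)
  finally have cP: "2 * (\<Sum>u\<in>V. d u * d u) - ?n * (\<Sum>u\<in>V. d u) \<le> int (card P)"
    using s1 s2 s3 by (simp add: sum_subtractf sum.distrib mult.commute)

  \<comment> \<open>The ends \<open>u\<close> and \<open>w\<close> need not be adjacent, so
    \<open>C\<close> may overcount the triangles with two equally colored edges at \<open>v\<close>;
    an upper bound suffices.\<close>
  define C where "C = (SIGMA v:V. {(u, w). u \<in> N v \<and> w \<in> N v \<and> u \<noteq> w \<and> c {v, u} = c {v, w}})"
  have finC1: "finite {(u, w). u \<in> N v \<and> w \<in> N v \<and> u \<noteq> w \<and> c {v, u} = c {v, w}}" for v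
    by (rule finite_subset[of _ "N v \<times> N v"]) (auto simp: finN)
  then have finC: "finite C" unfolding C_def using V by auto
  have "int (card C) = (\<Sum>v\<in>V. int (card {(u, w). u \<in> N v \<and> w \<in> N v \<and> u \<noteq> w \<and> c {v, u} = c {v, w}}))"
    unfolding C_def using V finC1 by (subst card_SigmaI) auto
  also have "\<dots> \<le> (\<Sum>v\<in>V. (d v - D v) * (d v - D v + 1))"
    unfolding D_eq d_def by (intro sum_mono card_pairs_same_value_le finN)
  finally have cC: "int (card C) \<le> (\<Sum>v\<in>V. (d v - D v) * (d v - D v + 1))" .

  define Q where "Q = (\<lambda>((u, v), w). (u, v, w)) ` P"
  have Q: "(u, v, w) \<in> Q \<longleftrightarrow> {u, v} \<in> E \<and> {u, w} \<in> E \<and> {v, w} \<in> E" for u v w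
  proof -
    have "(u, v, w) \<in> Q \<longleftrightarrow> u \<in> V \<and> v \<in> N u \<and> w \<in> N u \<and> w \<in> N v"
      by (force simp: Q_def P_def A_def)
    moreover have "u \<in> V" if "v \<in> N u" using that NV[of v] Nsym by blast
    ultimately show ?thesis unfolding N_def graph_nbrs_def by blast
  qed
  have cQ: "card Q = card P" unfolding Q_def by (intro card_image) (auto simp: inj_on_def)
  have finQ: "finite Q" unfolding Q_def using finP by simp
  \<comment> \<open>In a triple of \<open>C\<close> the common vertex of the two equally colored
    edges comes first; \<open>?f\<close> moves it to the second place and \<open>?g\<close> to the
    third.\<close>
  let ?f = "\<lambda>(u, v, w). (v, u, w)" and ?g = "\<lambda>(u, v, w). (v, w, u)"
  define B where "B = C \<union> ?f ` C \<union> ?g ` C"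
  have finB: "finite B" unfolding B_def using finC by simp
  have "card B \<le> card C + card C + card C"
    unfolding B_def using finC
    by (intro order_trans[OF card_Un_le] add_mono card_image_le order_refl)
  have rainbow: "{u, v, w} \<in> ?R" if q: "(u, v, w) \<in> Q - B" for u v w
  proof -
    have e: "{u, v} \<in> E" "{u, w} \<in> E" "{v, w} \<in> E" using q Q by auto
    from e[THEN subsetD[OF E]]
    have V3: "u \<in> V" "v \<in> V" "w \<in> V" "u \<noteq> v" "u \<noteq> w" "v \<noteq> w" by simp_all
    have "(u, v, w) \<notin> C" "(v, u, w) \<notin> C" "(w, u, v) \<notin> C"
      using q by (force simp: B_def)+
    then have ne: "c {u, v} \<noteq> c {u, w}" "c {v, u} \<noteq> c {v, w}" "c {w, u} \<noteq> c {w, v}"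
      using e V3 by (auto simp: C_def N_def graph_nbrs_def insert_commute)
    have n2: "nsets {u, v, w} 2 = {{u, v}, {u, w}, {v, w}}"
      using V3 by (auto simp: nsets_2_eq insert_commute)
    have "{u, v, w} \<in> nsets V 3" using V3 by (simp add: nsets_def)
    moreover have "inj_on c {{u, v}, {u, w}, {v, w}}"
      using ne by (auto simp: inj_on_def insert_commute)
    ultimately show ?thesis using e by (simp add: rainbow_triangle_def triangle_def n2)
  qed
  have R3: "?R \<subseteq> nsets V 3" by (auto simp: rainbow_triangle_def triangle_def)
  then have finR: "finite ?R" using V by (meson finite_imp_finite_nsets finite_subset)
  have "card (Q - B) \<le> 6 * card ?R" by (rule card_ordered_triples_le[OF finR R3 rainbow])
  moreover have "card Q \<le> card (Q - B) + card B"
    using finQ finB by (metis Un_Diff_cancel2 card_Un_le card_mono finite_UnI le_sup_iff order_trans subset_refl)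
  ultimately have "int (card P) \<le> 6 * int (card ?R) + 3 * int (card C)"
    using \<open>card B \<le> card C + card C + card C\<close> cQ by simp
  with cP cC have "2 * (\<Sum>u\<in>V. d u * d u) - ?n * (\<Sum>u\<in>V. d u)
      - 3 * (\<Sum>v\<in>V. (d v - D v) * (d v - D v + 1)) \<le> 6 * int (card ?R)"
    by simp
  also have "2 * (\<Sum>u\<in>V. d u * d u) - ?n * (\<Sum>u\<in>V. d u) - 3 * (\<Sum>v\<in>V. (d v - D v) * (d v - D v + 1))
      = (\<Sum>v\<in>V. 2 * (d v * d v) - ?n * d v - 3 * ((d v - D v) * (d v - D v + 1)))"
    by (simp add: sum_subtractf sum_distrib_left)
  finally have "(\<Sum>v\<in>V. 2 * (2 * (d v * d v) - ?n * d v - 3 * ((d v - D v) * (d v - D v + 1))))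
      \<le> 12 * int (card ?R)"
    unfolding sum_distrib_left[symmetric] by linarith
  moreover have "(\<Sum>v\<in>V. int k * (?n + int k))
      \<le> (\<Sum>v\<in>V. 2 * (2 * (d v * d v) - ?n * d v - 3 * ((d v - D v) * (d v - D v + 1))))"
  proof (rule sum_mono)
    fix v assume v: "v \<in> V"
    have D: "?n + int k \<le> 2 * D v" using deg[OF v] by (simp add: D_def)
    define x where "x = d v - D v"
    have x0: "x \<ge> 0" using card_image_le[OF finN, of "\<lambda>u. c {v, u}" v] by (simp add: x_def d_def D_eq)
    have "card (N v) \<le> card (V - {v})" using NV V by (intro card_mono) auto
    then have "d v \<le> ?n - 1" using v V n by (simp add: d_def of_nat_diff)
    then have x1: "x \<le> ?n - 1 - D v" by (simp add: x_def)
    have "int k * (?n + int k) \<le> int k * (2 * D v)" using D by (intro mult_left_mono) auto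
    \<comment> \<open>The added term collects everything due to the \<open>x\<close> surplus edges.
      Its second factor is nonnegative because \<open>x \<le> ?n - 1 - D v\<close> makes it at least
      \<open>3 * D v + int k - ?n - 2\<close>, where \<open>2 * D v \<ge> ?n + int k\<close> and
      \<open>?n \<ge> 6\<close>.\<close>
    also have "\<dots> \<le> 2 * (D v * int k + x * (2 * D v + int k - x - 3))"
    proof -
      have "0 \<le> x * (2 * D v + int k - x - 3)" using x0 x1 D n by (intro mult_nonneg_nonneg) linarith+
      then show ?thesis by (simp add: mult.commute)
    qed
    also have "\<dots> = 2 * (d v * (int k + 2 * x) - 3 * (x * (x + 1)))"
      by (simp add: x_def algebra_simps)
    also have "\<dots> \<le> 2 * (d v * (2 * d v - ?n) - 3 * (x * (x + 1)))"
    proof -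
      have "int k + 2 * x \<le> 2 * d v - ?n" using D by (simp add: x_def)
      then have "d v * (int k + 2 * x) \<le> d v * (2 * d v - ?n)"
        by (rule mult_left_mono) (simp add: d_def)
      then show ?thesis by simp
    qed
    finally show "int k * (?n + int k) \<le> 2 * (2 * (d v * d v) - ?n * d v - 3 * ((d v - D v) * (d v - D v + 1)))"
      by (simp add: x_def algebra_simps)
  qed
  ultimately show ?thesis by (simp add: algebra_simps)
qed

section \<open>Induction on the number of triangles\<close>

text \<open>A color lost at \<open>v\<close> appears on an edge from \<open>v\<close> into
  \<open>B\<close>, so each deleted vertex accounts for at most one lost color.\<close>

lemma color_degree_delete:
  assumes V: "finite V" and E: "E \<subseteq> nsets V 2" and B: "finite B" and v: "v \<notin> B"
  shows "color_degree E c v \<le> color_degree {e \<in> E. e \<inter> B = {}} c v + card B"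
proof -
  have finE: "finite E" using E V by (meson finite_imp_finite_nsets finite_subset)
  have "c ` {e \<in> E. v \<in> e} \<subseteq> c ` {e \<in> {e \<in> E. e \<inter> B = {}}. v \<in> e} \<union> (\<lambda>b. c {v, b}) ` B"
  proof
    fix a assume "a \<in> c ` {e \<in> E. v \<in> e}"
    then obtain u where u: "a = c {v, u}" "{v, u} \<in> E"
      unfolding edges_at_eq_image[OF E] by (auto simp: graph_nbrs_def)
    show "a \<in> c ` {e \<in> {e \<in> E. e \<inter> B = {}}. v \<in> e} \<union> (\<lambda>b. c {v, b}) ` B"
    proof (cases "u \<in> B")
      case False
      then have "{v, u} \<in> {e \<in> {e \<in> E. e \<inter> B = {}}. v \<in> e}" using u(2) v by simp
      then show ?thesis using u(1) by blast
    qed (use u(1) in blast)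
  qed
  then have "card (c ` {e \<in> E. v \<in> e})
      \<le> card (c ` {e \<in> {e \<in> E. e \<inter> B = {}}. v \<in> e} \<union> (\<lambda>b. c {v, b}) ` B)"
    using finE B by (intro card_mono) auto
  also have "\<dots> \<le> card (c ` {e \<in> {e \<in> E. e \<inter> B = {}}. v \<in> e}) + card ((\<lambda>b. c {v, b}) ` B)"
    by (rule card_Un_le)
  also have "card ((\<lambda>b. c {v, b}) ` B) \<le> card B" using B by (rule card_image_le)
  finally show ?thesis by (simp add: color_degree_def)
qed

lemma rainbow_triangle_delete:
  assumes "rainbow_triangle (V - B) {e \<in> E. e \<inter> B = {}} c T"
  shows "rainbow_triangle V E c T" "T \<inter> B = {}"
  using assms by (auto simp: rainbow_triangle_def triangle_def nsets_def)

text \<open>In terms of \<open>K = k - 1\<close> and the slack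
  \<open>y = 2 * n - 85 * k - 96\<close>, both nonnegative, four times the difference of the two
  sides is a polynomial with nonnegative coefficients and positive constant term. The factor four
  lets \<open>n\<close> enter only as \<open>2 * n\<close>.\<close>

lemma triple_count_gap:
  fixes n k :: int
  assumes "k > 0" "2 * n \<ge> 85 * k + 96"
  shows "12 * ((k - 1) * (3 * k - 2) * (n - 3 * k + 1) + 27 * (k - 1) ^ 3) < n * k * (n + k)"
proof -
  define K where "K = k - 1"
  define y where "y = 2 * n - 85 * k - 96"
  have K: "K \<ge> 0" and y: "y \<ge> 0" using assms by (simp_all add: K_def y_def)
  have k: "k = K + 1" and n: "2 * n = 85 * K + 181 + y" by (simp_all add: K_def y_def)
  have "4 * (n * k * (n + k)) = (2 * n) * (K + 1) * (2 * n + 2 * (K + 1))"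
    by (simp add: k algebra_simps)
  also have "\<dots> = (85 * K + 181 + y) * (K + 1) * (87 * K + 183 + y)"
    unfolding n by (simp add: algebra_simps)
  finally have l: "4 * (n * k * (n + k)) = (85 * K + 181 + y) * (K + 1) * (87 * K + 183 + y)" .
  have "48 * ((k - 1) * (3 * k - 2) * (n - 3 * k + 1) + 27 * (k - 1) ^ 3)
      = 24 * (K * (3 * K + 1) * (2 * n - 6 * K - 4)) + 1296 * K ^ 3"
    by (simp add: k algebra_simps)
  also have "\<dots> = 24 * (K * (3 * K + 1) * (79 * K + 177 + y)) + 1296 * K ^ 3"
    unfolding n by (simp add: algebra_simps)
  finally have r: "48 * ((k - 1) * (3 * k - 2) * (n - 3 * k + 1) + 27 * (k - 1) ^ 3)
      = 24 * (K * (3 * K + 1) * (79 * K + 177 + y)) + 1296 * K ^ 3" .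
  have "(85 * K + 181 + y) * (K + 1) * (87 * K + 183 + y)
      - (24 * (K * (3 * K + 1) * (79 * K + 177 + y)) + 1296 * K ^ 3)
      = 411 * K ^ 3 + 24057 * K ^ 2 + 60177 * K + 33123 + (100 * K ^ 2 + 512 * K + 364) * y + (K + 1) * y ^ 2"
    by (simp add: algebra_simps power2_eq_square power3_eq_cube)
  moreover have "\<dots> > 0"
    using K y by (intro add_pos_nonneg add_nonneg_pos) auto
  ultimately show ?thesis using l r by linarith
qed

text \<open>The induction is strong and varies the graph, since the packing argument deletes any
  nonempty set \<open>B\<close> of at most \<open>k\<close> vertices and asks for
  \<open>k - card B\<close> triangles in the rest.\<close>

lemma disjoint_rainbow_triangles:
  assumes "finite_simple_graph V E" "85 * k + 96 \<le> 2 * card V"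
    and "\<And>v. v \<in> V \<Longrightarrow> card V + k \<le> 2 * color_degree E c v"
  shows "\<exists>F\<subseteq>{T. rainbow_triangle V E c T}. disjoint F \<and> card F = k"
  using assms
proof (induction k arbitrary: V E rule: less_induct)
  case (less k)
  show ?case
  proof (cases "k = 0")
    case True
    then show ?thesis by (intro exI[of _ "{}"]) simp
  next
    case False
    let ?R = "{T. rainbow_triangle V E c T}"
    have V: "finite V" and E: "E \<subseteq> nsets V 2"
      using less.prems(1) by (simp_all add: finite_simple_graph_def)
    interpret triple_system V ?R
      using V by unfold_locales (auto simp: rainbow_triangle_def triangle_def)
    have avoid: "\<exists>F\<subseteq>?R. disjoint F \<and> card F = k - card B \<and> \<Union>F \<inter> B = {}"
      if B: "B \<subseteq> V" "B \<noteq> {}" "card B \<le> k" for B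
    proof -
      let ?E = "{e \<in> E. e \<inter> B = {}}"
      have finB: "finite B" using B(1) V finite_subset by blast
      then have cB: "card B > 0" using B(2) by (simp add: card_gt_0_iff)
      have cV: "card (V - B) = card V - card B" using B(1) finB by (simp add: card_Diff_subset)
      have "card B \<le> card V" using B(1) V card_mono by blast
      have "\<exists>F\<subseteq>{T. rainbow_triangle (V - B) ?E c T}. disjoint F \<and> card F = k - card B"
      proof (rule less.IH)
        show "k - card B < k" using cB False by simp
        show "finite_simple_graph (V - B) ?E"
          using V E unfolding finite_simple_graph_def nsets_def by blast
        show "85 * (k - card B) + 96 \<le> 2 * card (V - B)"
          using less.prems(2) B(3) cV by simp
        \<comment> \<open>The left side drops by exactly \<open>2 * card B\<close> and the right
          side by at most that much, so the degree condition survives the deletion.\<close>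
        show "card (V - B) + (k - card B) \<le> 2 * color_degree ?E c v" if "v \<in> V - B" for v
          using less.prems(3)[of v] color_degree_delete[OF V E finB, of v c] that cV B(3) \<open>card B \<le> card V\<close>
          by simp
      qed
      then obtain F where F: "F \<subseteq> {T. rainbow_triangle (V - B) ?E c T}" "disjoint F"
          "card F = k - card B"
        by blast
      have "T \<in> ?R \<and> T \<inter> B = {}" if "T \<in> F" for T
        using rainbow_triangle_delete[of V B E c T] F(1) that by auto
      then have "F \<subseteq> ?R" "\<Union>F \<inter> B = {}" by blast+
      with F(2,3) show ?thesis by metis
    qed
    show ?thesis
    proof (rule ccontr)
      assume "\<not> ?thesis"
      then have none: "card F \<noteq> k" if "F \<subseteq> ?R" "disjoint F" for F using that by blast
      have "int (card V) * int k * (int (card V) + int k) \<le> 12 * int (card ?R)"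
      proof (rule card_rainbow_triangles_ge[OF V E])
        show "k > 0" "card V \<ge> 6" using False less.prems(2) by simp_all
      qed (fact less.prems(3))
      also have "\<dots> \<le> 12 * ((int k - 1) * (3 * int k - 2) * (int (card V) - 3 * int k + 1)
          + 27 * (int k - 1) ^ 3)"
      proof (intro mult_left_mono card_triples_le)
        show "k > 0" using False by simp
        show "3 * k \<le> card V" using less.prems(2) by linarith
        have "card V \<noteq> 0" using less.prems(2) by linarith
        then show "V \<noteq> {}" by auto
      qed (fact none, fact avoid, simp)
      also have "\<dots> < int (card V) * int k * (int (card V) + int k)"
        using less.prems(2) False by (intro triple_count_gap) auto
      finally show False by simp
    qed
  qed
qed

theorem theorem4:
  fixes V :: "'a set" and E :: "'a set set" and c :: "'a set \<Rightarrow> nat" and n k :: nat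
  assumes "n > 0" and "k > 0"
    and "real n \<ge> 42.5 * real k + 48"
    and "finite_simple_graph V E"
    and "card V = n"
    and "real (min_color_degree V E c) \<ge> (real n + real k) / 2"
  shows "\<exists>\<T>. card \<T> = k \<and> (\<forall>T\<in>\<T>. rainbow_triangle V E c T) \<and> disjoint \<T>"
proof -
  \<comment> \<open>Doubling clears the fractions, so that both hypotheses become inequalities
    between natural numbers.\<close>
  have "real (85 * k + 96) \<le> real (2 * card V)" using assms(3,5) by simp
  then have "85 * k + 96 \<le> 2 * card V" by (simp only: of_nat_le_iff)
  moreover have "card V + k \<le> 2 * color_degree E c v" if "v \<in> V" for v
  proof -
    have "finite V" using assms(4) by (simp add: finite_simple_graph_def)
    then have "min_color_degree V E c \<le> color_degree E c v"
      using that unfolding min_color_degree_def by (intro Min_le) auto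
    with assms(5,6) have "real (card V + k) \<le> real (2 * color_degree E c v)" by simp
    then show ?thesis by (simp only: of_nat_le_iff)
  qed
  ultimately have "\<exists>F\<subseteq>{T. rainbow_triangle V E c T}. disjoint F \<and> card F = k"
    by (rule disjoint_rainbow_triangles[OF assms(4)])
  then show ?thesis by blast
qed

end
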